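(* Let $(\boldsymbol{x},\boldsymbol{n},\boldsymbol{s}):U\to\mathbb{R}^3\times\Delta$ be a framed surface with basic invariants $a_i,b_i,e_i,f_i,g_i$ ($i=1,2$). Then $(\boldsymbol{x},\boldsymbol{n},\boldsymbol{s})$ is a $(\boldsymbol{t},\overline{\boldsymbol{n}})$-Bertrand framed surface if and only if $\det(\boldsymbol{g}(u,v),\boldsymbol{a}(u,v))=0$ for all $(u,v)\in U$ and $\lambda:U\to\mathbb{R}$ is given by $$\lambda(u,v)=-\left(\int_{u_0}^{u}b_1(u,v)\,du+\int_{v_0}^{v}b_2(u_0,v)\,dv\right)+c$$ for a point $(u_0,v_0)\in U$ and a constant $c\in\mathbb{R}$ with $\lambda\not\equiv0$.
   Context: All maps are $C^\infty$. $U\subset\mathbb{R}^2$ is a simply connected domain with coordinates $(u,v)$, $S^2$ is the unit sphere in $\mathbb{R}^3$, and $\Delta=\{(\boldsymbol{p},\boldsymbol{q})\in S^2\times S^2 : \boldsymbol{p}\cdot\boldsymbol{q}=0\}$. A framed surface is a smooth map $(\boldsymbol{x},\boldsymbol{n},\boldsymbol{s}):U\to\mathbb{R}^3\times\Delta$ with $\boldsymbol{x}_u\cdot\boldsymbol{n}=\boldsymbol{x}_v\cdot\boldsymbol{n}=0$ on $U$. Put $\boldsymbol{t}=\boldsymbol{n}\times\boldsymbol{s}$. Its basic invariants are the smooth functions $a_i,b_i,e_i,f_i,g_i:U\to\mathbb{R}$ ($i=1,2$) determined by $\boldsymbol{x}_u=a_1\boldsymbol{s}+b_1\boldsymbol{t}$,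 $\boldsymbol{n}_u=e_1\boldsymbol{s}+f_1\boldsymbol{t}$, $\boldsymbol{s}_u=-e_1\boldsymbol{n}+g_1\boldsymbol{t}$, $\boldsymbol{t}_u=-f_1\boldsymbol{n}-g_1\boldsymbol{s}$, and the same equations with $\partial_v$ in place of $\partial_u$ and index $2$ in place of $1$. Write $\boldsymbol{a}=(a_1,a_2)$ and $\boldsymbol{g}=(g_1,g_2)$, so that $\det(\boldsymbol{g},\boldsymbol{a})=g_1a_2-g_2a_1$. For a smooth $\lambda:U\to\mathbb{R}$, $\lambda\not\equiv0$ means that $\{(u,v)\in U:\lambda(u,v)\neq0\}$ is dense in $U$. Two framed surfaces $(\boldsymbol{x},\boldsymbol{n},\boldsymbol{s}),(\overline{\boldsymbol{x}},\overline{\boldsymbol{n}},\overline{\boldsymbol{s}}):U\to\mathbb{R}^3\times\Delta$ are $(\boldsymbol{t},\overline{\boldsymbol{n}})$-mates if there is a smooth $\lambda:U\to\mathbb{R}$ with $\lambda\not\equiv0$ such that $\overline{\boldsymbol{x}}(u,v)=\boldsymbol{x}(u,v)+\lambda(u,v)\boldsymbol{t}(u,v)$ and $\boldsymbol{t}(u,v)=\overline{\boldsymbol{n}}(u,v)$ for all $(u,v)\in U$; the $\lambda$ in the claim is this function. $(\boldsymbol{x},\boldsymbol{n},\boldsymbol{s})$ is a $(\boldsymbol{t},\overline{\boldsymbol{n}})$-Bertrand framed surface if there is another framed surface $(\overline{\boldsymbol{x}},\overline{\boldsymbol{n}},\overline{\boldsymbol{s}}):U\to\mathbb{R}^3\times\Delta$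 such that the two are $(\boldsymbol{t},\overline{\boldsymbol{n}})$-mates.
   Formalization: Where the broken line from (u_0,v_0) via (u_0,v) to (u,v) leaves U, so that the displayed integrals are undefined, they are replaced by the line integral of b_1 du + b_2 dv along some piecewise C^1 path in U; elsewhere the formula is literal. *)

theory Defs
  imports "HOL-Analysis.Analysis"
begin

definition partial_u :: "(real \<times> real \<Rightarrow> 'a::real_normed_vector) \<Rightarrow> real \<times> real \<Rightarrow> 'a" where
  "partial_u f p = vector_derivative (\<lambda>u. f (u, snd p)) (at (fst p))"

definition partial_v :: "(real \<times> real \<Rightarrow> 'a::real_normed_vector) \<Rightarrow> real \<times> real \<Rightarrow> 'a" where
  "partial_v f p = vector_derivative (\<lambda>v. f (fst p, v)) (at (snd p))"

text \<open>The following two definitions are meant for open \<open>U\<close> only.\<close>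

primrec Ck_on :: "nat \<Rightarrow> 'a::real_normed_vector set \<Rightarrow> ('a \<Rightarrow> 'b::real_normed_vector) \<Rightarrow> bool" where
  "Ck_on 0 U f \<longleftrightarrow> continuous_on U f"
| "Ck_on (Suc k) U f \<longleftrightarrow>
     (\<forall>p\<in>U. f differentiable (at p)) \<and> (\<forall>h. Ck_on k U (\<lambda>p. frechet_derivative f (at p) h))"

definition smooth_on :: "'a::real_normed_vector set \<Rightarrow> ('a \<Rightarrow> 'b::real_normed_vector) \<Rightarrow> bool" where
  "smooth_on U f \<longleftrightarrow> (\<forall>k. Ck_on k U f)"

definition Delta :: "((real^3) \<times> (real^3)) set" where
  "Delta = {(p, q). p \<in> sphere 0 1 \<and> q \<in> sphere 0 1 \<and> p \<bullet> q = 0}"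

definition framed_surface ::
  "(real \<times> real) set \<Rightarrow> (real \<times> real \<Rightarrow> real^3) \<Rightarrow> (real \<times> real \<Rightarrow> real^3) \<Rightarrow> (real \<times> real \<Rightarrow> real^3) \<Rightarrow> bool"
  where
  "framed_surface U x n s \<longleftrightarrow>
     smooth_on U x \<and> smooth_on U n \<and> smooth_on U s \<and>
     (\<forall>p\<in>U. (n p, s p) \<in> Delta \<and> partial_u x p \<bullet> n p = 0 \<and> partial_v x p \<bullet> n p = 0)"

definition frame_t :: "(real \<times> real \<Rightarrow> real^3) \<Rightarrow> (real \<times> real \<Rightarrow> real^3) \<Rightarrow> real \<times> real \<Rightarrow> real^3" where
  "frame_t n s p = cross3 (n p) (s p)"

definition basic_invariants ::
  "(real \<times> real) set \<Rightarrow> (real \<times> real \<Rightarrow> real^3) \<Rightarrow> (real \<times> real \<Rightarrow> real^3) \<Rightarrow> (real \<times> real \<Rightarrow> real^3) \<Rightarrow>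
   (real \<times> real \<Rightarrow> real) \<Rightarrow> (real \<times> real \<Rightarrow> real) \<Rightarrow> (real \<times> real \<Rightarrow> real) \<Rightarrow> (real \<times> real \<Rightarrow> real) \<Rightarrow>
   (real \<times> real \<Rightarrow> real) \<Rightarrow> (real \<times> real \<Rightarrow> real) \<Rightarrow> (real \<times> real \<Rightarrow> real) \<Rightarrow> (real \<times> real \<Rightarrow> real) \<Rightarrow>
   (real \<times> real \<Rightarrow> real) \<Rightarrow> (real \<times> real \<Rightarrow> real) \<Rightarrow> bool"
  where
  "basic_invariants U x n s a1 b1 e1 f1 g1 a2 b2 e2 f2 g2 \<longleftrightarrow>
     (\<forall>h \<in> {a1, b1, e1, f1, g1, a2, b2, e2, f2, g2}. smooth_on U h) \<and>
     (\<forall>p\<in>U. let t = frame_t n s in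
        partial_u x p = a1 p *\<^sub>R s p + b1 p *\<^sub>R t p \<and>
        partial_u n p = e1 p *\<^sub>R s p + f1 p *\<^sub>R t p \<and>
        partial_u s p = - e1 p *\<^sub>R n p + g1 p *\<^sub>R t p \<and>
        partial_u t p = - f1 p *\<^sub>R n p - g1 p *\<^sub>R s p \<and>
        partial_v x p = a2 p *\<^sub>R s p + b2 p *\<^sub>R t p \<and>
        partial_v n p = e2 p *\<^sub>R s p + f2 p *\<^sub>R t p \<and>
        partial_v s p = - e2 p *\<^sub>R n p + g2 p *\<^sub>R t p \<and>
        partial_v t p = - f2 p *\<^sub>R n p - g2 p *\<^sub>R s p)"

definition not_ident_zero :: "(real \<times> real) set \<Rightarrow> (real \<times> real \<Rightarrow> real) \<Rightarrow> bool" where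
  "not_ident_zero U l \<longleftrightarrow> U \<subseteq> closure {p \<in> U. l p \<noteq> 0}"

definition tn_mates_via ::
  "(real \<times> real) set \<Rightarrow> (real \<times> real \<Rightarrow> real) \<Rightarrow>
   (real \<times> real \<Rightarrow> real^3) \<Rightarrow> (real \<times> real \<Rightarrow> real^3) \<Rightarrow> (real \<times> real \<Rightarrow> real^3) \<Rightarrow>
   (real \<times> real \<Rightarrow> real^3) \<Rightarrow> (real \<times> real \<Rightarrow> real^3) \<Rightarrow> (real \<times> real \<Rightarrow> real^3) \<Rightarrow> bool"
  where
  "tn_mates_via U l x n s x' n' s' \<longleftrightarrow>
     framed_surface U x n s \<and> framed_surface U x' n' s' \<and>
     smooth_on U l \<and> not_ident_zero U l \<and>
     (\<forall>p\<in>U. x' p = x p + l p *\<^sub>R frame_t n s p \<and> frame_t n s p = n' p)"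

definition tn_mates ::
  "(real \<times> real) set \<Rightarrow>
   (real \<times> real \<Rightarrow> real^3) \<Rightarrow> (real \<times> real \<Rightarrow> real^3) \<Rightarrow> (real \<times> real \<Rightarrow> real^3) \<Rightarrow>
   (real \<times> real \<Rightarrow> real^3) \<Rightarrow> (real \<times> real \<Rightarrow> real^3) \<Rightarrow> (real \<times> real \<Rightarrow> real^3) \<Rightarrow> bool"
  where
  "tn_mates U x n s x' n' s' \<longleftrightarrow> (\<exists>l. tn_mates_via U l x n s x' n' s')"

text \<open>A mate is automatically different from \<open>(x, n, s)\<close> if \<open>U\<close> is nonempty, because
  \<open>n' = n \<times> s\<close> is orthogonal to \<open>n\<close>.\<close>

definition tn_bertrand ::
  "(real \<times> real) set \<Rightarrow> (real \<times> real \<Rightarrow> real^3) \<Rightarrow> (real \<times> real \<Rightarrow> real^3) \<Rightarrow> (real \<times> real \<Rightarrow> real^3) \<Rightarrow> bool"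
  where
  "tn_bertrand U x n s \<longleftrightarrow>
     (\<exists>x' n' s'. framed_surface U x' n' s' \<and> tn_mates U x n s x' n' s')"

definition line_integral ::
  "(real \<Rightarrow> real \<times> real) \<Rightarrow> (real \<times> real \<Rightarrow> real) \<Rightarrow> (real \<times> real \<Rightarrow> real) \<Rightarrow> real" where
  "line_integral \<gamma> P Q =
     integral {0..1} (\<lambda>\<tau>. P (\<gamma> \<tau>) * fst (vector_derivative \<gamma> (at \<tau> within {0..1})) +
                          Q (\<gamma> \<tau>) * snd (vector_derivative \<gamma> (at \<tau> within {0..1})))"

text \<open>The iterated integral \<open>\<integral>\<^bsub>u\<^sub>0\<^esub>\<^bsup>u\<^esup> b\<^sub>1(u,v) du + \<integral>\<^bsub>v\<^sub>0\<^esub>\<^bsup>v\<^esup> b\<^sub>2(u\<^sub>0,v) dv\<close> is the line integral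
  of \<open>b\<^sub>1 du + b\<^sub>2 dv\<close> along the broken line \<open>(u\<^sub>0,v\<^sub>0) \<rightarrow> (u\<^sub>0,v) \<rightarrow> (u,v)\<close>, so it is defined only if
  that line lies in \<open>U\<close>. For the other points of a general simply connected \<open>U\<close>, the broken line is
  replaced by some path in \<open>U\<close> from \<open>(u\<^sub>0,v\<^sub>0)\<close> to \<open>(u,v)\<close>.\<close>

definition lambda_formula ::
  "(real \<times> real) set \<Rightarrow> (real \<times> real \<Rightarrow> real) \<Rightarrow> (real \<times> real \<Rightarrow> real) \<Rightarrow>
   real \<Rightarrow> real \<Rightarrow> real \<Rightarrow> (real \<times> real \<Rightarrow> real) \<Rightarrow> bool"
  where
  "lambda_formula U b1 b2 u0 v0 c l \<longleftrightarrow>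
     (\<forall>u v. (u, v) \<in> U \<longrightarrow>
       (if closed_segment (u0, v0) (u0, v) \<union> closed_segment (u0, v) (u, v) \<subseteq> U
        then l (u, v) = - ((LBINT \<xi>=u0..u. b1 (\<xi>, v)) + (LBINT \<eta>=v0..v. b2 (u0, \<eta>))) + c
        else \<exists>\<gamma>. valid_path \<gamma> \<and> path_image \<gamma> \<subseteq> U \<and> pathstart \<gamma> = (u0, v0) \<and> pathfinish \<gamma> = (u, v) \<and>
               l (u, v) = - line_integral \<gamma> b1 b2 + c))"

end

theory Submission
  imports Defs "HOL-Complex_Analysis.Riemann_Mapping"
begin

text \<open>Adding \<open>l t\<close> to \<open>x\<close> changes the component of \<open>x\<^sub>u\<close> along \<open>t\<close> from \<open>b\<^sub>1\<close> to \<open>b\<^sub>1 + l\<^sub>u\<close>, and that of \<open>x\<^sub>v\<close>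
  from \<open>b\<^sub>2\<close> to \<open>b\<^sub>2 + l\<^sub>v\<close>. A framed surface with base \<open>x + l t\<close> and normal \<open>t\<close> therefore exists iff
  \<open>dl = - \<omega>\<close> with \<open>\<omega> = b\<^sub>1 du + b\<^sub>2 dv\<close> (\<open>mates_via_iff\<close>). So everything is about potentials of
  \<open>\<omega>\<close>: the \<open>t\<close>-component of \<open>x\<^sub>u\<^sub>v = x\<^sub>v\<^sub>u\<close> says that \<open>\<omega>\<close> is closed iff \<open>det(g, a) = 0\<close>
  (\<open>integrability_condition\<close>), and, once \<open>\<omega>\<close> has a potential \<open>F\<close>, the formula for
  \<open>\<lambda>\<close> says that \<open>\<lambda> + F\<close> is constant (\<open>lambda_formula_iff_potential\<close>).

  If \<open>l\<close> gives a mate, then \<open>- l\<close> is a potential of \<open>\<omega>\<close>, so \<open>\<omega>\<close> is closed. If conversely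
  \<open>det(g, a) = 0\<close>, then a potential exists because \<open>U\<close> is simply connected
  (\<open>poincare_simply_connected\<close>). This last fact is the only global one. It is reduced to the unit
  disc by the Riemann mapping theorem: pulling back along a conformal map preserves closedness, and
  on a convex set the potential is the integral of the form along the segments from the origin.\<close>

section \<open>Calculus of \<open>C\<^sup>k\<close> maps\<close>

lemma Ck_on_SucD:
  assumes "Ck_on (Suc k) U f"
  shows "p \<in> U \<Longrightarrow> (f has_derivative frechet_derivative f (at p)) (at p)"
    and "Ck_on k U (\<lambda>p. frechet_derivative f (at p) h)"
  using assms by (auto simp: frechet_derivative_works[symmetric])

lemma Ck_on_lower: "Ck_on (Suc k) U f \<Longrightarrow> Ck_on k U f"
proof (induction k arbitrary: f)
  case 0
  then show ?case
    by (auto intro!: continuous_at_imp_continuous_on differentiable_imp_continuous_within)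
next
  case (Suc k)
  then show ?case
    by (metis Ck_on.simps(2))
qed

lemma Ck_on_cong:
  assumes "open U" "\<And>p. p \<in> U \<Longrightarrow> f p = g p" "Ck_on k U f"
  shows "Ck_on k U g"
  using assms(2,3)
proof (induction k arbitrary: f g)
  case 0
  then show ?case by (simp cong: continuous_on_cong)
next
  case (Suc k)
  have D: "(g has_derivative frechet_derivative f (at p)) (at p)" if "p \<in> U" for p
    using has_derivative_transform_within_open[OF Ck_on_SucD(1)[OF Suc.prems(2) that] assms(1) that]
      Suc.prems(1) by blast
  have "Ck_on k U (\<lambda>p. frechet_derivative g (at p) h)" for h
  proof (rule Suc.IH)
    show "frechet_derivative f (at p) h = frechet_derivative g (at p) h" if "p \<in> U" for p
      using frechet_derivative_at[OF D[OF that]] by simp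
  qed (rule Ck_on_SucD(2)[OF Suc.prems(2)])
  then show ?case using D by (auto simp: differentiable_def)
qed

text \<open>Any pointwise derivative will do to establish \<open>C\<^sup>k\<^sup>+\<^sup>1\<close>: derivatives are unique, and
  \<open>C\<^sup>k\<close> on an open set depends only on the values there.\<close>
lemma Ck_on_SucI:
  assumes "open U" "\<And>p. p \<in> U \<Longrightarrow> (f has_derivative f' p) (at p)"
    and "\<And>h. Ck_on k U (\<lambda>p. f' p h)"
  shows "Ck_on (Suc k) U f"
proof -
  have "Ck_on k U (\<lambda>p. frechet_derivative f (at p) h)" for h
    by (rule Ck_on_cong[OF assms(1) _ assms(3)[of h]]) (simp add: frechet_derivative_at[OF assms(2), symmetric])
  then show ?thesis using assms(2) by (auto simp: differentiable_def)
qed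

lemma Ck_on_const: "Ck_on k U (\<lambda>_. c)"
  by (induction k arbitrary: c) auto

lemma Ck_on_add:
  assumes "open U" "Ck_on k U f" "Ck_on k U g"
  shows "Ck_on k U (\<lambda>p. f p + g p)"
  using assms(2,3)
proof (induction k arbitrary: f g)
  case 0
  then show ?case by (auto intro: continuous_intros)
next
  case (Suc k)
  note D = Ck_on_SucD[OF Suc.prems(1)] Ck_on_SucD[OF Suc.prems(2)]
  show ?case
    by (rule Ck_on_SucI[OF assms(1) has_derivative_add[OF D(1) D(3)] Suc.IH[OF D(2) D(4)]])
qed

text \<open>The product rule expresses the derivative of \<open>B f g\<close> through \<open>B\<close> applied to \<open>f\<close>, \<open>g\<close>
  and their derivatives, so induction on \<open>k\<close> covers the inner product, the cross product and
  both kinds of multiplication by functions at once.\<close>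
lemma Ck_on_bilinear:
  assumes "open U" "bounded_bilinear B" "Ck_on k U f" "Ck_on k U g"
  shows "Ck_on k U (\<lambda>p. B (f p) (g p))"
  using assms(3,4)
proof (induction k arbitrary: f g)
  case 0
  then show ?case by (auto intro: bounded_bilinear.continuous_on[OF assms(2)])
next
  case (Suc k)
  note D = Ck_on_SucD[OF Suc.prems(1)] Ck_on_SucD[OF Suc.prems(2)]
  show ?case
    by (rule Ck_on_SucI[OF assms(1) bounded_bilinear.FDERIV[OF assms(2) D(1) D(3)]
          Ck_on_add[OF assms(1) Suc.IH[OF Ck_on_lower[OF Suc.prems(1)] D(4)]
                                Suc.IH[OF D(2) Ck_on_lower[OF Suc.prems(2)]]]])
qed

section \<open>Symmetry of second derivatives\<close>

text \<open>The mean value theorem in the direction \<open>h\<close> turns the double difference into a simple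
  difference of \<open>f' _ h\<close>, and the mean value theorem in the direction \<open>k\<close> then finishes. The
  left-hand side is symmetric in \<open>h\<close> and \<open>k\<close>, which is what makes it useful.\<close>
lemma mixed_difference_mean_value:
  fixes f :: "'a::real_normed_vector \<Rightarrow> real"
  assumes t: "0 < t"
    and f': "\<And>a b. 0 \<le> a \<Longrightarrow> a \<le> t \<Longrightarrow> 0 \<le> b \<Longrightarrow> b \<le> t \<Longrightarrow>
      (f has_derivative f' (p + a *\<^sub>R h + b *\<^sub>R k)) (at (p + a *\<^sub>R h + b *\<^sub>R k))"
    and f'': "\<And>a b. 0 \<le> a \<Longrightarrow> a \<le> t \<Longrightarrow> 0 \<le> b \<Longrightarrow> b \<le> t \<Longrightarrow>
      ((\<lambda>q. f' q h) has_derivative f'' (p + a *\<^sub>R h + b *\<^sub>R k)) (at (p + a *\<^sub>R h + b *\<^sub>R k))"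
  obtains a b where "0 < a" "a < t" "0 < b" "b < t"
    "f (p + t *\<^sub>R h + t *\<^sub>R k) - f (p + t *\<^sub>R h) - f (p + t *\<^sub>R k) + f p =
     t\<^sup>2 * f'' (p + a *\<^sub>R h + b *\<^sub>R k) k"
proof -
  have Dh: "((\<lambda>a. f (p + a *\<^sub>R h + b *\<^sub>R k)) has_real_derivative f' (p + a *\<^sub>R h + b *\<^sub>R k) h) (at a)"
    if "0 \<le> a" "a \<le> t" "0 \<le> b" "b \<le> t" for a b
  proof -
    have "((\<lambda>a. f (p + a *\<^sub>R h + b *\<^sub>R k)) has_derivative (\<lambda>c. f' (p + a *\<^sub>R h + b *\<^sub>R k) (c *\<^sub>R h))) (at a)"
      by (rule has_derivative_compose[where f = "\<lambda>a. p + a *\<^sub>R h + b *\<^sub>R k" and g = f, OF _ f'[OF that]]) (auto intro!: derivative_eq_intros)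
    then show ?thesis
      using linear_cmul[OF has_derivative_linear[OF f'[OF that]]]
      by (simp add: has_field_derivative_def mult_commute_abs)
  qed
  have Dk: "((\<lambda>b. f' (p + a *\<^sub>R h + b *\<^sub>R k) h) has_real_derivative f'' (p + a *\<^sub>R h + b *\<^sub>R k) k) (at b)"
    if "0 \<le> a" "a \<le> t" "0 \<le> b" "b \<le> t" for a b
  proof -
    have "((\<lambda>b. f' (p + a *\<^sub>R h + b *\<^sub>R k) h) has_derivative (\<lambda>c. f'' (p + a *\<^sub>R h + b *\<^sub>R k) (c *\<^sub>R k))) (at b)"
      by (rule has_derivative_compose[where f = "\<lambda>b. p + a *\<^sub>R h + b *\<^sub>R k" and g = "\<lambda>q. f' q h", OF _ f''[OF that]]) (auto intro!: derivative_eq_intros)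
    then show ?thesis
      using linear_cmul[OF has_derivative_linear[OF f''[OF that]]]
      by (simp add: has_field_derivative_def mult_commute_abs)
  qed
  let ?G = "\<lambda>a. f (p + a *\<^sub>R h + t *\<^sub>R k) - f (p + a *\<^sub>R h + 0 *\<^sub>R k)"
  have "\<exists>z>0. z < t \<and> ?G t - ?G 0 = (t - 0) * (f' (p + z *\<^sub>R h + t *\<^sub>R k) h - f' (p + z *\<^sub>R h + 0 *\<^sub>R k) h)"
    using t by (intro MVT2 DERIV_diff Dh) auto
  then obtain a where a: "0 < a" "a < t"
    and eq: "?G t - ?G 0 = (t - 0) * (f' (p + a *\<^sub>R h + t *\<^sub>R k) h - f' (p + a *\<^sub>R h + 0 *\<^sub>R k) h)" by blast
  have "\<exists>z>0. z < t \<and> f' (p + a *\<^sub>R h + t *\<^sub>R k) h - f' (p + a *\<^sub>R h + 0 *\<^sub>R k) h = (t - 0) * f'' (p + a *\<^sub>R h + z *\<^sub>R k) k"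
    using t a by (intro MVT2 Dk) auto
  then obtain b where "0 < b" "b < t"
    "f' (p + a *\<^sub>R h + t *\<^sub>R k) h - f' (p + a *\<^sub>R h + 0 *\<^sub>R k) h = (t - 0) * f'' (p + a *\<^sub>R h + b *\<^sub>R k) k" by blast
  then show ?thesis using that[OF a, of b] eq by (simp add: power2_eq_square)
qed

text \<open>Evaluating the double difference over the parallelogram with sides \<open>t h\<close>, \<open>t k\<close> in both
  orders gives equal values of the two mixed derivatives at points that tend to \<open>p\<close> with \<open>t\<close>;
  continuity carries the equality over to \<open>p\<close>. Only real-valued functions are treated, since the
  mean value theorem needs them; vector-valued ones are reduced to them by an inner product with
  a constant vector.\<close>
lemma second_derivative_symmetric:
  fixes f :: "'a::real_normed_vector \<Rightarrow> real"
  assumes "open U" "p \<in> U" "Ck_on 2 U f"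
  shows "frechet_derivative (\<lambda>q. frechet_derivative f (at q) h) (at p) k =
         frechet_derivative (\<lambda>q. frechet_derivative f (at q) k) (at p) h"
proof -
  define f' where "f' q = frechet_derivative f (at q)" for q
  define f'' where "f'' h q = frechet_derivative (\<lambda>q. f' q h) (at q)" for h q
  have f2: "Ck_on (Suc (Suc 0)) U f" using assms(3) by (simp add: numeral_2_eq_2)
  have f': "(f has_derivative f' q) (at q)" if "q \<in> U" for q
    unfolding f'_def using Ck_on_SucD(1)[OF f2 that] .
  have f'': "((\<lambda>q. f' q h) has_derivative f'' h q) (at q)" if "q \<in> U" for q h
    unfolding f''_def unfolding f'_def using Ck_on_SucD(1)[OF Ck_on_SucD(2)[OF f2] that] .
  have cont: "isCont (\<lambda>q. f'' h q k) p" for h k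
  proof -
    have "Ck_on 0 U (\<lambda>q. f'' h q k)"
      unfolding f''_def unfolding f'_def by (rule Ck_on_SucD(2)[OF Ck_on_SucD(2)[OF f2]])
    then show ?thesis using assms(1,2) by (simp add: continuous_on_eq_continuous_at)
  qed
  have "\<bar>f'' h p k - f'' k p h\<bar> \<le> e" if "0 < e" for e
  proof -
    obtain d0 where d0: "d0 > 0" "ball p d0 \<subseteq> U"
      using assms(1,2) openE by blast
    obtain d1 where d1: "d1 > 0" "\<And>q. dist q p < d1 \<Longrightarrow> dist (f'' h q k) (f'' h p k) < e/2"
      using cont[of h k] \<open>0 < e\<close> unfolding continuous_at_eps_delta by (metis half_gt_zero)
    obtain d2 where d2: "d2 > 0" "\<And>q. dist q p < d2 \<Longrightarrow> dist (f'' k q h) (f'' k p h) < e/2"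
      using cont[of k h] \<open>0 < e\<close> unfolding continuous_at_eps_delta by (metis half_gt_zero)
    define d where "d = min d0 (min d1 d2)"
    \<comment> \<open>this side length keeps the whole parallelogram within distance \<open>d\<close> of \<open>p\<close>\<close>
    define t where "t = d / (norm h + norm k + 1)"
    have d: "d > 0" using d0 d1 d2 by (simp add: d_def)
    have t: "t > 0" using d by (auto simp: t_def intro!: divide_pos_pos add_nonneg_pos)
    have near: "dist (p + a *\<^sub>R h + b *\<^sub>R k) p < d" if "0 \<le> a" "a \<le> t" "0 \<le> b" "b \<le> t" for a b
    proof -
      have "dist (p + a *\<^sub>R h + b *\<^sub>R k) p = norm (a *\<^sub>R h + b *\<^sub>R k)" by (simp add: dist_norm add.assoc)
      also have "\<dots> \<le> a * norm h + b * norm k"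
        using norm_triangle_ineq[of "a *\<^sub>R h" "b *\<^sub>R k"] that by simp
      also have "\<dots> \<le> t * norm h + t * norm k" using that by (intro add_mono mult_right_mono) auto
      also have "\<dots> < t * (norm h + norm k + 1)" using t by (simp add: algebra_simps)
      also have "\<dots> = d"
        using add_nonneg_pos[of "norm h + norm k" 1] by (simp add: t_def)
      finally show ?thesis .
    qed
    have inU: "p + a *\<^sub>R h + b *\<^sub>R k \<in> U" if "0 \<le> a" "a \<le> t" "0 \<le> b" "b \<le> t" for a b
      using near[OF that] d0(2) by (auto simp: d_def dist_commute)
    have inU': "p + a *\<^sub>R k + b *\<^sub>R h \<in> U" if "0 \<le> a" "a \<le> t" "0 \<le> b" "b \<le> t" for a b
      using inU[of b a] that by (simp add: algebra_simps)
    obtain a b where ab: "0 < a" "a < t" "0 < b" "b < t"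
      "f (p + t *\<^sub>R h + t *\<^sub>R k) - f (p + t *\<^sub>R h) - f (p + t *\<^sub>R k) + f p = t\<^sup>2 * f'' h (p + a *\<^sub>R h + b *\<^sub>R k) k"
      by (rule mixed_difference_mean_value[OF t f'[OF inU] f''[OF inU]])
    obtain a' b' where ab': "0 < a'" "a' < t" "0 < b'" "b' < t"
      "f (p + t *\<^sub>R k + t *\<^sub>R h) - f (p + t *\<^sub>R k) - f (p + t *\<^sub>R h) + f p = t\<^sup>2 * f'' k (p + a' *\<^sub>R k + b' *\<^sub>R h) h"
      by (rule mixed_difference_mean_value[OF t f'[OF inU'] f''[OF inU']])
    have "t\<^sup>2 * f'' h (p + a *\<^sub>R h + b *\<^sub>R k) k = t\<^sup>2 * f'' k (p + a' *\<^sub>R k + b' *\<^sub>R h) h"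
      using ab(5) ab'(5) by (simp add: algebra_simps)
    then have "f'' h (p + a *\<^sub>R h + b *\<^sub>R k) k = f'' k (p + b' *\<^sub>R h + a' *\<^sub>R k) h"
      using t by (simp add: algebra_simps)
    moreover have "dist (f'' h (p + a *\<^sub>R h + b *\<^sub>R k) k) (f'' h p k) < e/2"
      using near[of a b] ab by (intro d1) (auto simp: d_def)
    moreover have "dist (f'' k (p + b' *\<^sub>R h + a' *\<^sub>R k) h) (f'' k p h) < e/2"
      using near[of b' a'] ab' by (intro d2) (auto simp: d_def)
    ultimately show ?thesis unfolding dist_real_def by linarith
  qed
  then have "\<bar>f'' h p k - f'' k p h\<bar> \<le> 0" by (meson dense_ge)
  then show ?thesis unfolding f''_def f'_def by simp
qed

section \<open>Potentials of closed one-forms\<close>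

text \<open>A one-form is represented by a vector field \<open>W\<close>, acting as \<open>h \<mapsto> W z \<bullet> h\<close>; it is closed iff
  the derivative of \<open>W\<close> is self-adjoint. The potential is \<open>F z = \<integral>\<^sub>0\<^sup>1 W (t z) \<bullet> z dt\<close>. Differentiating under
  the integral sign in the direction \<open>h\<close> gives the integrand
  \<open>W (t z) \<bullet> h + t (W' (t z) h \<bullet> z)\<close>, which by self-adjointness is the \<open>t\<close>-derivative of
  \<open>t (W (t z) \<bullet> h)\<close> and therefore integrates to \<open>W z \<bullet> h\<close>.\<close>
lemma poincare_convex:
  fixes W :: "'a::euclidean_space \<Rightarrow> 'a"
  assumes S: "open S" "convex S" "0 \<in> S"
    and W: "\<And>z. z \<in> S \<Longrightarrow> (W has_derivative W' z) (at z)"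
    and cont: "\<And>h. continuous_on S (\<lambda>z. W' z h)"
    and closed: "\<And>z h k. z \<in> S \<Longrightarrow> W' z h \<bullet> k = W' z k \<bullet> h"
  shows "\<exists>F. \<forall>z\<in>S. (F has_derivative (\<lambda>h. W z \<bullet> h)) (at z)"
proof (intro exI ballI)
  \<comment> \<open>the derivative of the integrand \<open>W (t z) \<bullet> z\<close> with respect to \<open>z\<close>\<close>
  define w where "w z t = Blinfun (\<lambda>h. W (t *\<^sub>R z) \<bullet> h + t * (W' (t *\<^sub>R z) h \<bullet> z))" for z :: 'a and t :: real
  have inS: "t *\<^sub>R z \<in> S" if "z \<in> S" "t \<in> cbox 0 1" for z and t :: real
    using mem_convex_alt[OF S(2,3) that(1), of "1 - t" t] that(2) by simp
  have lin: "bounded_linear (W' z)" if "z \<in> S" for z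
    using W[OF that] by (rule has_derivative_bounded_linear)
  have w: "blinfun_apply (w z t) = (\<lambda>h. W (t *\<^sub>R z) \<bullet> h + t * (W' (t *\<^sub>R z) h \<bullet> z))"
    if "z \<in> S" "t \<in> cbox 0 1" for z t
    unfolding w_def
    by (rule bounded_linear_Blinfun_apply)
      (intro bounded_linear_add bounded_linear_inner_right bounded_linear_mult_const
        bounded_linear_const_mult bounded_linear_compose[OF bounded_linear_inner_left] lin inS that)
  have contW: "continuous_on S W"
    using W by (auto intro!: continuous_at_imp_continuous_on has_derivative_continuous)
  fix z assume z: "z \<in> S"
  have "((\<lambda>z. integral (cbox 0 1) (\<lambda>t. W (t *\<^sub>R z) \<bullet> z)) has_derivative integral (cbox 0 1) (w z)) (at z within S)"
  proof (rule leibniz_rule)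
    show "((\<lambda>z. W (t *\<^sub>R z) \<bullet> z) has_derivative blinfun_apply (w z t)) (at z within S)"
      if "z \<in> S" "t \<in> cbox 0 1" for z t
    proof -
      have "((\<lambda>z. W (t *\<^sub>R z)) has_derivative (\<lambda>h. W' (t *\<^sub>R z) (t *\<^sub>R h))) (at z within S)"
        by (rule has_derivative_compose[where f = "\<lambda>z. t *\<^sub>R z" and g = W, OF _ W[OF inS[OF that]]])
          (auto intro!: derivative_eq_intros)
      then have "((\<lambda>z. W (t *\<^sub>R z) \<bullet> z) has_derivative
                 (\<lambda>h. W (t *\<^sub>R z) \<bullet> h + W' (t *\<^sub>R z) (t *\<^sub>R h) \<bullet> z)) (at z within S)"
        by (intro has_derivative_inner has_derivative_ident)
      then show ?thesis
        unfolding w[OF that]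
        using linear_cmul[OF bounded_linear.linear[OF lin[OF inS[OF that]]]] by simp
    qed
    show "(\<lambda>t. W (t *\<^sub>R z) \<bullet> z) integrable_on cbox 0 1" if "z \<in> S" for z
      using inS[OF that]
      by (intro integrable_continuous continuous_intros continuous_on_compose2[OF contW]) auto
    show "continuous_on (S \<times> cbox 0 1) (\<lambda>(z, t). w z t)"
    proof (rule continuous_on_blinfun_componentwise)
      fix i :: 'a
      have "continuous_on (S \<times> cbox 0 1)
         (\<lambda>p. W (snd p *\<^sub>R fst p) \<bullet> i + snd p * (W' (snd p *\<^sub>R fst p) i \<bullet> fst p))"
        using inS
        by (intro continuous_intros continuous_on_compose2[OF contW] continuous_on_compose2[OF cont[of i]]) auto
      then show "continuous_on (S \<times> cbox 0 1) (\<lambda>p. blinfun_apply (case p of (z, t) \<Rightarrow> w z t) i)"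
        by (rule continuous_on_eq) (auto simp: w)
    qed
  qed (use S z in auto)
  moreover have "blinfun_apply (integral (cbox 0 1) (w z)) = (\<lambda>h. W z \<bullet> h)"
  proof
    fix h
    have wint: "w z integrable_on cbox 0 1"
    proof (intro integrable_continuous continuous_on_blinfun_componentwise)
      fix i :: 'a
      have "continuous_on (cbox 0 1) (\<lambda>t. W (t *\<^sub>R z) \<bullet> i + t * (W' (t *\<^sub>R z) i \<bullet> z))"
        using inS[OF z]
        by (intro continuous_intros continuous_on_compose2[OF contW] continuous_on_compose2[OF cont[of i]]) auto
      then show "continuous_on (cbox 0 1) (\<lambda>t. blinfun_apply (w z t) i)"
        by (rule continuous_on_eq) (auto simp: w z)
    qed
    have "((\<lambda>t. t * (W (t *\<^sub>R z) \<bullet> h)) has_vector_derivative blinfun_apply (w z t) h) (at t within {0..1})"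
      if "t \<in> {0..1}" for t
    proof -
      have t: "t \<in> cbox 0 1" using that by simp
      have "((\<lambda>t. W (t *\<^sub>R z)) has_derivative (\<lambda>s. W' (t *\<^sub>R z) (s *\<^sub>R z))) (at t within {0..1})"
        by (rule has_derivative_compose[where f = "\<lambda>t. t *\<^sub>R z" and g = W, OF _ W[OF inS[OF z t]]])
          (auto intro!: derivative_eq_intros)
      then have "((\<lambda>t. t * (W (t *\<^sub>R z) \<bullet> h)) has_derivative
         (\<lambda>s. t * (W' (t *\<^sub>R z) (s *\<^sub>R z) \<bullet> h) + s * (W (t *\<^sub>R z) \<bullet> h))) (at t within {0..1})"
        by (intro has_derivative_mult has_derivative_ident has_derivative_inner_left)
      moreover have "W' (t *\<^sub>R z) (s *\<^sub>R z) = s *\<^sub>R W' (t *\<^sub>R z) z" for s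
        using linear_cmul[OF bounded_linear.linear[OF lin[OF inS[OF z t]]]] .
      ultimately show ?thesis
        unfolding has_vector_derivative_def w[OF z t]
        using closed[OF inS[OF z t], of z h] by (simp add: algebra_simps)
    qed
    then have "((\<lambda>t. blinfun_apply (w z t) h) has_integral (1 * (W (1 *\<^sub>R z) \<bullet> h) - 0 * (W (0 *\<^sub>R z) \<bullet> h))) {0..1}"
      by (intro fundamental_theorem_of_calculus) auto
    then show "blinfun_apply (integral (cbox 0 1) (w z)) h = W z \<bullet> h"
      using blinfun_apply_integral[OF wint, of h] by (simp add: integral_unique)
  qed
  ultimately show "((\<lambda>z. integral (cbox 0 1) (\<lambda>t. W (t *\<^sub>R z) \<bullet> z)) has_derivative (\<lambda>h. W z \<bullet> h)) (at z)"
    using S(1) z by (simp add: at_within_open[OF z S(1)])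
qed

text \<open>Conjugation gives the adjoint of a complex multiplication; this is how a one-form is pulled
  back along a holomorphic map.\<close>
lemma inner_cnj_mult_left: "(cnj a * w) \<bullet> h = w \<bullet> (a * h)" for a w h :: complex
  by (simp add: inner_complex_def algebra_simps)

text \<open>By the Riemann mapping theorem, a nonempty simply connected open \<open>S\<close> is the whole plane or
  there are mutually inverse holomorphic maps \<open>f : S \<rightarrow> D\<close> and \<open>g : D \<rightarrow> S\<close> with the unit disc \<open>D\<close>.
  The plane is convex. In the other case, the pull-back of a closed form along \<open>g\<close> is closed, has
  a potential on the convex set \<open>D\<close>, and composing that potential with \<open>f\<close> gives one on \<open>S\<close>.\<close>
lemma poincare_simply_connected_complex:
  fixes W :: "complex \<Rightarrow> complex"
  assumes S: "open S" "simply_connected S"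
    and W: "\<And>z. z \<in> S \<Longrightarrow> (W has_derivative W' z) (at z)"
    and cont: "\<And>h. continuous_on S (\<lambda>z. W' z h)"
    and closed: "\<And>z h k. z \<in> S \<Longrightarrow> W' z h \<bullet> k = W' z k \<bullet> h"
  shows "\<exists>F. \<forall>z\<in>S. (F has_derivative (\<lambda>h. W z \<bullet> h)) (at z)"
proof -
  consider "S = {}" | "S = UNIV" |
    f g where "f holomorphic_on S" "g holomorphic_on ball 0 1"
      "\<forall>z\<in>S. f z \<in> ball 0 1 \<and> g (f z) = z" "\<forall>z\<in>ball 0 1. g z \<in> S \<and> f (g z) = z"
    using Riemann_mapping_theorem[of S] S by blast
  then show ?thesis
  proof cases
    case 1
    then show ?thesis by simp
  next
    case 2
    then show ?thesis using poincare_convex[of S W W'] W cont closed by auto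
  next
    case (3 f g)
    define D where "D = ball (0::complex) 1"
    have D: "open D" "convex D" "0 \<in> D" by (auto simp: D_def)
    have f: "(f has_field_derivative deriv f z) (at z)" if "z \<in> S" for z
      using holomorphic_derivI[OF 3(1) S(1) that] .
    have g_in: "g z \<in> S" if "z \<in> D" for z using 3(4) that by (auto simp: D_def)
    have f_in: "f z \<in> D" if "z \<in> S" for z using 3(3) that by (auto simp: D_def)
    have holg: "g holomorphic_on D" "deriv g holomorphic_on D" "deriv (deriv g) holomorphic_on D"
      using 3(2) D(1) by (auto simp: D_def intro!: holomorphic_deriv)
    have g: "(g has_field_derivative deriv g z) (at z)"
      and g': "(deriv g has_field_derivative deriv (deriv g) z) (at z)" if "z \<in> D" for z
      using holomorphic_derivI[OF _ D(1) that] holg by auto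
    have contg: "continuous_on D g" "continuous_on D (deriv g)" "continuous_on D (deriv (deriv g))"
      using holg by (auto intro: holomorphic_on_imp_continuous_on)
    have contW: "continuous_on S W"
      using W by (auto intro!: continuous_at_imp_continuous_on has_derivative_continuous)
    \<comment> \<open>the pull-back of \<open>W\<close> along \<open>g\<close>: \<open>V z \<bullet> h = W (g z) \<bullet> (g' z * h)\<close>\<close>
    define V where "V z = cnj (deriv g z) * W (g z)" for z
    define V' where "V' z h = cnj (deriv g z) * W' (g z) (deriv g z * h)
       + cnj (deriv (deriv g) z * h) * W (g z)" for z h
    \<comment> \<open>continuity of \<open>W'\<close> is given for fixed directions only, but the pull-back uses the variable direction \<open>g' z * h\<close>\<close>
    have lin: "W' z c = Re c *\<^sub>R W' z 1 + Im c *\<^sub>R W' z \<i>" if "z \<in> S" for z c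
    proof -
      have "linear (W' z)" using W[OF that] by (rule has_derivative_linear)
      then have "W' z (Re c *\<^sub>R 1 + Im c *\<^sub>R \<i>) = Re c *\<^sub>R W' z 1 + Im c *\<^sub>R W' z \<i>"
        by (simp only: linear_add linear_cmul)
      moreover have "Re c *\<^sub>R 1 + Im c *\<^sub>R \<i> = c" by (simp add: complex_eq_iff)
      ultimately show ?thesis by simp
    qed
    have "\<exists>F. \<forall>z\<in>D. (F has_derivative (\<lambda>h. V z \<bullet> h)) (at z)"
    proof (rule poincare_convex[OF D])
      show "(V has_derivative V' z) (at z)" if "z \<in> D" for z
      proof -
        have "((\<lambda>z. W (g z)) has_derivative (\<lambda>h. W' (g z) (deriv g z * h))) (at z)"
          using has_derivative_compose[where f = g and g = W, OF _ W[OF g_in[OF that]]]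
            g[OF that] by (simp add: has_field_derivative_def)
        moreover have "((\<lambda>z. cnj (deriv g z)) has_derivative (\<lambda>h. cnj (deriv (deriv g) z * h))) (at z)"
          using g'[OF that] by (intro has_derivative_cnj) (simp add: has_field_derivative_def)
        ultimately show ?thesis unfolding V_def[abs_def] V'_def[abs_def]
          by (intro has_derivative_mult)
      qed
      show "continuous_on D (\<lambda>z. V' z h)" for h
      proof -
        have "continuous_on D (\<lambda>z. cnj (deriv g z) * (Re (deriv g z * h) *\<^sub>R W' (g z) 1
          + Im (deriv g z * h) *\<^sub>R W' (g z) \<i>) + cnj (deriv (deriv g) z * h) * W (g z))"
          using g_in
          by (intro continuous_intros contg continuous_on_compose2[OF contW]
              continuous_on_compose2[OF cont[of 1]] continuous_on_compose2[OF cont[of \<i>]]) auto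
        then show ?thesis
          unfolding V'_def by (rule continuous_on_eq) (metis lin g_in)
      qed
      \<comment> \<open>one summand is the closedness of \<open>W\<close> in the directions \<open>g' h\<close>, \<open>g' k\<close>, the other is \<open>W \<bullet> (g'' h k)\<close>\<close>
      show "V' z h \<bullet> k = V' z k \<bullet> h" if "z \<in> D" for z h k
        using closed[OF g_in[OF that], of "deriv g z * h" "deriv g z * k"]
        by (simp add: V'_def inner_add_left inner_cnj_mult_left mult.assoc mult.left_commute del: complex_cnj_mult)
           (simp add: ac_simps)
    qed
    then obtain F where F: "\<And>z. z \<in> D \<Longrightarrow> (F has_derivative (\<lambda>h. V z \<bullet> h)) (at z)" by blast
    have "((\<lambda>z. F (f z)) has_derivative (\<lambda>h. W z \<bullet> h)) (at z)" if "z \<in> S" for z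
    proof -
      have gf: "g (f z) = z" using 3(3) that by blast
      have "((\<lambda>z. g (f z)) has_field_derivative deriv g (f z) * deriv f z) (at z)"
        using DERIV_chain2[OF g[OF f_in[OF that]] f[OF that]] by simp
      then have "((\<lambda>z. z) has_field_derivative deriv g (f z) * deriv f z) (at z)"
        by (rule has_field_derivative_transform_within_open[OF _ S(1) that]) (use 3(3) in auto)
      then have one: "deriv g (f z) * deriv f z = 1"
        using DERIV_ident DERIV_unique by blast
      have "((\<lambda>z. F (f z)) has_derivative (\<lambda>h. V (f z) \<bullet> (deriv f z * h))) (at z)"
        using has_derivative_compose[where f = f and g = F, OF _ F[OF f_in[OF that]]]
            f[OF that] by (simp add: has_field_derivative_def)
      then show ?thesis
        using one by (simp add: V_def inner_cnj_mult_left gf mult.assoc[symmetric])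
    qed
    then show ?thesis by blast
  qed
qed

text \<open>The complex version, read through \<open>(u, v) \<mapsto> u + i v\<close>. The hypothesis compares
  \<open>P\<^sub>v\<close> with \<open>Q\<^sub>u\<close>, which are the off-diagonal entries of the derivative of the field \<open>(P, Q)\<close>.\<close>
lemma poincare_simply_connected:
  fixes P Q :: "real \<times> real \<Rightarrow> real"
  assumes U: "open U" "simply_connected U"
    and PQ: "Ck_on 1 U P" "Ck_on 1 U Q"
    and closed: "\<And>p. p \<in> U \<Longrightarrow> frechet_derivative P (at p) (0, 1) = frechet_derivative Q (at p) (1, 0)"
  shows "\<exists>F. \<forall>p\<in>U. (F has_derivative (\<lambda>h. P p * fst h + Q p * snd h)) (at p)"
proof -
  define j where "j z = (Re z, Im z)" for z
  define i where "i p = Complex (fst p) (snd p)" for p :: "real \<times> real"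
  have ij: "i (j z) = z" "j (i p) = p" for z p by (auto simp: i_def j_def)
  have blj: "bounded_linear j" unfolding j_def
    by (intro bounded_linear_Pair bounded_linear_Re bounded_linear_Im)
  have i_eq: "i = (\<lambda>p. fst p *\<^sub>R 1 + snd p *\<^sub>R \<i>)" by (auto simp: i_def complex_eq_iff)
  have bli: "bounded_linear i" unfolding i_eq
    by (intro bounded_linear_add bounded_linear_scaleR_const bounded_linear_fst bounded_linear_snd)
  note contj = bounded_linear.continuous_on[OF blj continuous_on_id]
  note conti = bounded_linear.continuous_on[OF bli continuous_on_id]
  define S where "S = j -` U"
  have "open S"
    unfolding S_def using contj U(1) by (simp add: open_vimage)
  have "S = i ` U" by (auto simp: S_def ij(2) image_iff) (metis ij(1))
  have "homeomorphism U S i j"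
    unfolding homeomorphism_def \<open>S = i ` U\<close>
    using ij conti contj by (auto intro: continuous_on_subset simp: image_image)
  then have "simply_connected S"
    using U(2) homeomorphic_simply_connected_eq homeomorphic_def by blast
  note DP = Ck_on_SucD[OF PQ(1)[unfolded One_nat_def]]
  note DQ = Ck_on_SucD[OF PQ(2)[unfolded One_nat_def]]
  define W where "W z = i (P (j z), Q (j z))" for z
  define W' where "W' z h = i (frechet_derivative P (at (j z)) (j h), frechet_derivative Q (at (j z)) (j h))" for z h
  have jd: "(j has_derivative j) (at z)" for z by (rule bounded_linear_imp_has_derivative[OF blj])
  have "\<exists>F. \<forall>z\<in>S. (F has_derivative (\<lambda>h. W z \<bullet> h)) (at z)"
  proof (rule poincare_simply_connected_complex[OF \<open>open S\<close> \<open>simply_connected S\<close>])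
    show "(W has_derivative W' z) (at z)" if "z \<in> S" for z
      unfolding W_def W'_def
      using that unfolding S_def vimage_eq
      by (intro bounded_linear.has_derivative[OF bli] has_derivative_Pair
          has_derivative_compose[OF jd DP(1)] has_derivative_compose[OF jd DQ(1)])
    show "continuous_on S (\<lambda>z. W' z h)" for h
      unfolding W'_def
      using DP(2)[of "j h"] DQ(2)[of "j h"]
      by (intro bounded_linear.continuous_on[OF bli] continuous_on_Pair
          continuous_on_compose2[OF _ continuous_on_subset[OF contj]]) (auto simp: S_def)
    show "W' z h \<bullet> k = W' z k \<bullet> h" if "z \<in> S" for z h k
    proof -
      have jz: "j z \<in> U" using that by (simp add: S_def)
      have lin: "G (j c) = Re c * G (1, 0) + Im c * G (0, 1)" if "linear G" for c and G :: "real \<times> real \<Rightarrow> real"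
      proof -
        have "j c = Re c *\<^sub>R (1, 0) + Im c *\<^sub>R (0, 1)" by (simp add: j_def)
        then show ?thesis using that by (simp only: linear_add linear_cmul real_scaleR_def)
      qed
      show ?thesis
        using closed[OF jz]
        by (simp add: W'_def i_def inner_complex_def lin[OF has_derivative_linear[OF DP(1)[OF jz]]]
            lin[OF has_derivative_linear[OF DQ(1)[OF jz]]] algebra_simps)
    qed
  qed
  then obtain F where F: "\<And>z. z \<in> S \<Longrightarrow> (F has_derivative (\<lambda>h. W z \<bullet> h)) (at z)" by blast
  have "((\<lambda>p. F (i p)) has_derivative (\<lambda>h. P p * fst h + Q p * snd h)) (at p)" if "p \<in> U" for p
  proof -
    have "i p \<in> S" using that ij by (simp add: S_def)
    have "((\<lambda>p. F (i p)) has_derivative (\<lambda>h. W (i p) \<bullet> i h)) (at p)"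
      by (rule has_derivative_compose[OF bounded_linear_imp_has_derivative[OF bli] F[OF \<open>i p \<in> S\<close>]])
    then show ?thesis by (simp add: W_def ij) (simp add: i_def inner_complex_def)
  qed
  then show ?thesis by blast
qed

text \<open>Exactness implies closedness on any open set: \<open>P\<^sub>v\<close> and \<open>Q\<^sub>u\<close> are the two mixed second
  derivatives of the potential.\<close>
lemma potential_imp_closed:
  fixes F P Q :: "real \<times> real \<Rightarrow> real"
  assumes U: "open U" "p \<in> U"
    and F: "\<And>p. p \<in> U \<Longrightarrow> (F has_derivative (\<lambda>h. P p * fst h + Q p * snd h)) (at p)"
    and PQ: "Ck_on 1 U P" "Ck_on 1 U Q"
  shows "frechet_derivative P (at p) (0, 1) = frechet_derivative Q (at p) (1, 0)"
proof -
  have "Ck_on 1 U (\<lambda>p. P p * fst h + Q p * snd h)" for h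
    by (intro Ck_on_add U Ck_on_bilinear[OF _ bounded_bilinear_mult] PQ Ck_on_const)
  then have "Ck_on (Suc 1) U F"
    using Ck_on_SucI[where f = F and f' = "\<lambda>p h. P p * fst h + Q p * snd h", OF U(1) F] by blast
  then have "Ck_on 2 U F" by (simp add: numeral_2_eq_2)
  note sym = second_derivative_symmetric[OF U this, of "(1, 0)" "(0, 1)"]
  have D: "(P has_derivative frechet_derivative P (at p)) (at p)"
    "(Q has_derivative frechet_derivative Q (at p)) (at p)"
    using Ck_on_SucD(1)[OF _ U(2)] PQ unfolding One_nat_def by blast+
  have "((\<lambda>q. frechet_derivative F (at q) (1, 0)) has_derivative frechet_derivative P (at p)) (at p)"
    by (rule has_derivative_transform_within_open[OF D(1) U]) (simp add: frechet_derivative_at[OF F, symmetric])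
  moreover have "((\<lambda>q. frechet_derivative F (at q) (0, 1)) has_derivative frechet_derivative Q (at p)) (at p)"
    by (rule has_derivative_transform_within_open[OF D(2) U]) (simp add: frechet_derivative_at[OF F, symmetric])
  ultimately show ?thesis using sym by (metis frechet_derivative_at)
qed

section \<open>The integral formula in terms of a potential\<close>

lemma line_integral_potential:
  assumes F: "\<And>p. p \<in> U \<Longrightarrow> (F has_derivative (\<lambda>h. P p * fst h + Q p * snd h)) (at p)"
    and \<gamma>: "valid_path \<gamma>" "path_image \<gamma> \<subseteq> U"
  shows "line_integral \<gamma> P Q = F (pathfinish \<gamma>) - F (pathstart \<gamma>)"
proof -
  obtain K where K: "finite K" "\<gamma> C1_differentiable_on ({0..1} - K)"
    and cont: "continuous_on {0..1} \<gamma>"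
    using \<gamma>(1) by (auto simp: valid_path_def piecewise_C1_differentiable_on_def)
  have inU: "\<gamma> t \<in> U" if "t \<in> {0..1}" for t
    using \<gamma>(2) that by (auto simp: path_image_def)
  have "((\<lambda>t. P (\<gamma> t) * fst (vector_derivative \<gamma> (at t within {0..1})) +
              Q (\<gamma> t) * snd (vector_derivative \<gamma> (at t within {0..1})))
         has_integral F (\<gamma> 1) - F (\<gamma> 0)) {0..1}"
  proof (rule fundamental_theorem_of_calculus_interior_strong[OF K(1)])
    fix t :: real assume t: "t \<in> {0<..<1} - K"
    have "\<gamma> differentiable at t"
      using K(2) t by (auto simp: C1_differentiable_on_eq)
    then have D: "(\<gamma> has_vector_derivative vector_derivative \<gamma> (at t)) (at t)"
      by (simp add: vector_derivative_works)
    have eq: "vector_derivative \<gamma> (at t within {0..1}) = vector_derivative \<gamma> (at t)"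
      using t by (simp add: at_within_Icc_at)
    have "((\<lambda>t. F (\<gamma> t)) has_derivative (\<lambda>r.
        P (\<gamma> t) * fst (r *\<^sub>R vector_derivative \<gamma> (at t)) +
        Q (\<gamma> t) * snd (r *\<^sub>R vector_derivative \<gamma> (at t)))) (at t)"
      using D t inU unfolding has_vector_derivative_def
      by (intro has_derivative_compose[where f = \<gamma> and g = F, OF _ F]) auto
    then show "((\<lambda>t. F (\<gamma> t)) has_vector_derivative
        P (\<gamma> t) * fst (vector_derivative \<gamma> (at t within {0..1})) +
        Q (\<gamma> t) * snd (vector_derivative \<gamma> (at t within {0..1}))) (at t)"
      unfolding has_vector_derivative_def eq by (simp add: algebra_simps)
  next
    have "continuous_on U F"
      using F by (auto intro!: continuous_at_imp_continuous_on has_derivative_continuous)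
    then show "continuous_on {0..1} (\<lambda>t. F (\<gamma> t))"
      by (rule continuous_on_compose2[OF _ cont]) (use inU in auto)
  qed simp
  then show ?thesis
    by (simp add: line_integral_def integral_unique pathfinish_def pathstart_def)
qed

text \<open>The vertical leg contributes \<open>F (u0, v) - F (u0, v0)\<close> and the horizontal one
  \<open>F (u, v) - F (u0, v)\<close>.\<close>
lemma broken_line_integral_potential:
  assumes F: "\<And>p. p \<in> U \<Longrightarrow> (F has_derivative (\<lambda>h. P p * fst h + Q p * snd h)) (at p)"
    and cont: "continuous_on U P" "continuous_on U Q"
    and seg: "closed_segment (u0, v0) (u0, v) \<union> closed_segment (u0, v) (u, v) \<subseteq> U"
  shows "(LBINT \<xi>=u0..u. P (\<xi>, v)) + (LBINT \<eta>=v0..v. Q (u0, \<eta>)) = F (u, v) - F (u0, v0)"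
proof -
  have h: "(\<xi>, v) \<in> U" if "\<xi> \<in> {min u0 u..max u0 u}" for \<xi>
  proof -
    have "\<xi> \<in> closed_segment u0 u"
      using that by (auto simp: closed_segment_eq_real_ivl min_def max_def split: if_splits)
    then have "(\<xi>, v) \<in> closed_segment (u0, v) (u, v)"
      by (auto simp: in_segment algebra_simps)
    then show ?thesis using seg by blast
  qed
  have v: "(u0, \<eta>) \<in> U" if "\<eta> \<in> {min v0 v..max v0 v}" for \<eta>
  proof -
    have "\<eta> \<in> closed_segment v0 v"
      using that by (auto simp: closed_segment_eq_real_ivl min_def max_def split: if_splits)
    then have "(u0, \<eta>) \<in> closed_segment (u0, v0) (u0, v)"
      by (auto simp: in_segment algebra_simps)
    then show ?thesis using seg by blast
  qed
  have "(LBINT \<xi>=u0..u. P (\<xi>, v)) = F (u, v) - F (u0, v)"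
  proof (rule interval_integral_FTC_finite)
    show "continuous_on {min u0 u..max u0 u} (\<lambda>\<xi>. P (\<xi>, v))"
      by (rule continuous_on_compose2[OF cont(1)]) (use h in \<open>auto intro!: continuous_intros\<close>)
    show "((\<lambda>\<xi>. F (\<xi>, v)) has_vector_derivative P (\<xi>, v)) (at \<xi> within {min u0 u..max u0 u})"
      if "min u0 u \<le> \<xi>" "\<xi> \<le> max u0 u" for \<xi>
    proof -
      have "(\<xi>, v) \<in> U" using h that by simp
      have "((\<lambda>\<xi>. (\<xi>, v)) has_derivative (\<lambda>r. (r, 0))) (at \<xi> within {min u0 u..max u0 u})"
        by (auto intro!: derivative_eq_intros)
      from has_derivative_compose[OF this F[OF \<open>(\<xi>, v) \<in> U\<close>]]
      show ?thesis by (simp add: has_vector_derivative_def mult.commute)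
    qed
  qed
  moreover have "(LBINT \<eta>=v0..v. Q (u0, \<eta>)) = F (u0, v) - F (u0, v0)"
  proof (rule interval_integral_FTC_finite)
    show "continuous_on {min v0 v..max v0 v} (\<lambda>\<eta>. Q (u0, \<eta>))"
      by (rule continuous_on_compose2[OF cont(2)]) (use v in \<open>auto intro!: continuous_intros\<close>)
    show "((\<lambda>\<eta>. F (u0, \<eta>)) has_vector_derivative Q (u0, \<eta>)) (at \<eta> within {min v0 v..max v0 v})"
      if "min v0 v \<le> \<eta>" "\<eta> \<le> max v0 v" for \<eta>
    proof -
      have "(u0, \<eta>) \<in> U" using v that by simp
      have "((\<lambda>\<eta>. (u0, \<eta>)) has_derivative (\<lambda>r. (0, r))) (at \<eta> within {min v0 v..max v0 v})"
        by (auto intro!: derivative_eq_intros)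
      from has_derivative_compose[OF this F[OF \<open>(u0, \<eta>) \<in> U\<close>]]
      show ?thesis by (simp add: has_vector_derivative_def mult.commute)
    qed
  qed
  ultimately show ?thesis by simp
qed

text \<open>Once a potential \<open>F\<close> of \<open>P du + Q dv\<close> exists, integration along any path yields the
  increment of \<open>F\<close>, so the path chosen for the individual point is immaterial. For the
  direction from right to left, the points that the broken line does not reach inside \<open>U\<close> are
  reached by a polynomial path.\<close>
lemma lambda_formula_iff_potential:
  assumes U: "open U" "connected U" "(u0, v0) \<in> U"
    and F: "\<And>p. p \<in> U \<Longrightarrow> (F has_derivative (\<lambda>h. P p * fst h + Q p * snd h)) (at p)"
    and cont: "continuous_on U P" "continuous_on U Q"
  shows "lambda_formula U P Q u0 v0 c l \<longleftrightarrow> (\<forall>p\<in>U. l p = - (F p - F (u0, v0)) + c)"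
proof -
  have path: "(\<exists>\<gamma>. valid_path \<gamma> \<and> path_image \<gamma> \<subseteq> U \<and> pathstart \<gamma> = (u0, v0) \<and> pathfinish \<gamma> = (u, v) \<and>
               l (u, v) = - line_integral \<gamma> P Q + c) \<longleftrightarrow> l (u, v) = - (F (u, v) - F (u0, v0)) + c"
    if uv: "(u, v) \<in> U" for u v
  proof -
    obtain \<gamma> where "polynomial_function \<gamma>" and \<gamma>: "path_image \<gamma> \<subseteq> U"
      "pathstart \<gamma> = (u0, v0)" "pathfinish \<gamma> = (u, v)"
      using connected_open_polynomial_connected[OF U uv] by blast
    then have "valid_path \<gamma>" by (simp add: valid_path_polynomial_function)
    then show ?thesis using \<gamma> line_integral_potential[OF F] by metis
  qed
  show ?thesis
    unfolding lambda_formula_def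
    using broken_line_integral_potential[OF F cont] path by (auto split: if_splits)
qed

section \<open>Framed surfaces\<close>

lemma partial_eq_derivative:
  assumes "(f has_derivative f') (at p)"
  shows "partial_u f p = f' (1, 0)" "partial_v f p = f' (0, 1)"
proof -
  have p: "(f has_derivative f') (at (fst p, snd p))" using assms by simp
  have u: "((\<lambda>u. (u, snd p)) has_derivative (\<lambda>r. r *\<^sub>R (1, 0))) (at (fst p))"
    by (auto intro!: derivative_eq_intros)
  have v: "((\<lambda>v. (fst p, v)) has_derivative (\<lambda>r. r *\<^sub>R (0, 1))) (at (snd p))"
    by (auto intro!: derivative_eq_intros)
  show "partial_u f p = f' (1, 0)" "partial_v f p = f' (0, 1)"
    unfolding partial_u_def partial_v_def
    using has_derivative_compose[OF u p] has_derivative_compose[OF v p]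
      linear_cmul[OF has_derivative_linear[OF assms]]
    by (auto intro!: vector_derivative_at simp: has_vector_derivative_def simp del: scaleR_Pair)
qed

lemma framed_surface_orthonormal:
  assumes "framed_surface U x n s" "p \<in> U"
  shows "n p \<bullet> n p = 1" "s p \<bullet> s p = 1" "frame_t n s p \<bullet> frame_t n s p = 1"
    "n p \<bullet> s p = 0" "n p \<bullet> frame_t n s p = 0" "s p \<bullet> frame_t n s p = 0"
proof -
  have *: "norm (n p) = 1" "norm (s p) = 1" "n p \<bullet> s p = 0"
    using assms by (auto simp: framed_surface_def Delta_def)
  then show "n p \<bullet> n p = 1" "s p \<bullet> s p = 1" "n p \<bullet> s p = 0"
    by (simp_all add: dot_square_norm)
  then show "frame_t n s p \<bullet> frame_t n s p = 1"
    by (simp add: frame_t_def dot_cross inner_commute)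
  show "n p \<bullet> frame_t n s p = 0" "s p \<bullet> frame_t n s p = 0"
    by (simp_all add: frame_t_def dot_cross_self)
qed

lemma smooth_on_frame_t:
  assumes "open U" "smooth_on U n" "smooth_on U s"
  shows "smooth_on U (frame_t n s)"
proof -
  have "bounded_bilinear cross3" using bilinear_cross bilinear_conv_bounded_bilinear by blast
  then show ?thesis
    using Ck_on_bilinear[OF assms(1), of cross3] assms(2,3)
    unfolding smooth_on_def frame_t_def[abs_def] by blast
qed

lemma smooth_onD:
  assumes "smooth_on U f" "p \<in> U"
  shows "(f has_derivative frechet_derivative f (at p)) (at p)"
  using assms Ck_on_SucD(1) unfolding smooth_on_def by blast

text \<open>This is the \<open>t\<close>-component of \<open>x\<^sub>u\<^sub>v = x\<^sub>v\<^sub>u\<close>: differentiating \<open>x\<^sub>u = a\<^sub>1 s + b\<^sub>1 t\<close> by \<open>v\<close> gives the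
  component \<open>a\<^sub>1 g\<^sub>2 + b\<^sub>1\<^sub>v\<close>, and differentiating \<open>x\<^sub>v = a\<^sub>2 s + b\<^sub>2 t\<close> by \<open>u\<close> gives \<open>a\<^sub>2 g\<^sub>1 + b\<^sub>2\<^sub>u\<close>. Hence
  \<open>b\<^sub>1 du + b\<^sub>2 dv\<close> is closed exactly where \<open>det(g, a)\<close> vanishes.\<close>
lemma integrability_condition:
  assumes U: "open U" "p \<in> U"
    and fs: "framed_surface U x n s"
    and bi: "basic_invariants U x n s a1 b1 e1 f1 g1 a2 b2 e2 f2 g2"
  shows "frechet_derivative b1 (at p) (0, 1) - frechet_derivative b2 (at p) (1, 0) = g1 p * a2 p - g2 p * a1 p"
proof -
  define t where "t = frame_t n s"
  define w where "w = t p"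
  \<comment> \<open>\<open>w\<close> is the value of \<open>t\<close> at \<open>p\<close>, so \<open>\<phi>\<close> is real-valued with derivative \<open>x' \<bullet> w\<close>, and its second derivatives at \<open>p\<close> are the \<open>t\<close>-components there\<close>
  define \<phi> where "\<phi> q = x q \<bullet> w" for q
  have sm: "smooth_on U x" "smooth_on U n" "smooth_on U s"
    using fs by (auto simp: framed_surface_def)
  have smt: "smooth_on U t" unfolding t_def by (rule smooth_on_frame_t[OF U(1) sm(2,3)])
  have smi: "smooth_on U a1" "smooth_on U a2" "smooth_on U b1" "smooth_on U b2"
    using bi by (auto simp: basic_invariants_def)
  note on = framed_surface_orthonormal[OF fs U(2), folded t_def]
  have "Ck_on 2 U \<phi>"
    unfolding \<phi>_def using sm(1)
    by (intro Ck_on_bilinear[OF U(1) bounded_bilinear_inner] Ck_on_const) (simp add: smooth_on_def)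
  note sym = second_derivative_symmetric[OF U this, of "(1, 0)" "(0, 1)"]
  have \<phi>': "frechet_derivative \<phi> (at q) = (\<lambda>h. frechet_derivative x (at q) h \<bullet> w)" if "q \<in> U" for q
    unfolding \<phi>_def
    by (rule frechet_derivative_at[symmetric], rule has_derivative_inner_left, rule smooth_onD[OF sm(1) that])
  have x': "frechet_derivative \<phi> (at q) (1, 0) = a1 q * (s q \<bullet> w) + b1 q * (t q \<bullet> w)"
    "frechet_derivative \<phi> (at q) (0, 1) = a2 q * (s q \<bullet> w) + b2 q * (t q \<bullet> w)" if "q \<in> U" for q
    using bi that
    by (simp_all add: partial_eq_derivative[OF smooth_onD[OF sm(1) that], symmetric] \<phi>'[OF that] basic_invariants_def Let_def t_def[symmetric] inner_add_left)
  have s': "frechet_derivative s (at p) (1, 0) \<bullet> w = g1 p" "frechet_derivative s (at p) (0, 1) \<bullet> w = g2 p"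
    using bi U(2) on
    by (simp_all add: partial_eq_derivative[OF smooth_onD[OF sm(3) U(2)], symmetric]
        basic_invariants_def Let_def t_def[symmetric] inner_diff_left w_def)
  have t': "frechet_derivative t (at p) (1, 0) \<bullet> w = 0" "frechet_derivative t (at p) (0, 1) \<bullet> w = 0"
    using bi U(2) on
    by (simp_all add: partial_eq_derivative[OF smooth_onD[OF smt U(2)], symmetric] basic_invariants_def Let_def t_def[symmetric] inner_diff_left w_def)
  have D: "frechet_derivative \<psi> (at p) h =
      a p * (frechet_derivative s (at p) h \<bullet> w) + b p * (frechet_derivative t (at p) h \<bullet> w) + frechet_derivative b (at p) h"
    if ab: "smooth_on U a" "smooth_on U b"
      and eq: "\<And>q. q \<in> U \<Longrightarrow> \<psi> q = a q * (s q \<bullet> w) + b q * (t q \<bullet> w)" for a b \<psi> h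
  proof -
    have "((\<lambda>q. a q * (s q \<bullet> w) + b q * (t q \<bullet> w)) has_derivative
      (\<lambda>h. (a p * (frechet_derivative s (at p) h \<bullet> w) + frechet_derivative a (at p) h * (s p \<bullet> w)) +
           (b p * (frechet_derivative t (at p) h \<bullet> w) + frechet_derivative b (at p) h * (t p \<bullet> w)))) (at p)"
      by (intro has_derivative_add has_derivative_mult has_derivative_inner_left smooth_onD[OF _ U(2)] ab sm smt)
    then have "(\<psi> has_derivative
      (\<lambda>h. (a p * (frechet_derivative s (at p) h \<bullet> w) + frechet_derivative a (at p) h * (s p \<bullet> w)) +
           (b p * (frechet_derivative t (at p) h \<bullet> w) + frechet_derivative b (at p) h * (t p \<bullet> w)))) (at p)"
      by (rule has_derivative_transform_within_open[OF _ U]) (simp add: eq)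
    from frechet_derivative_at[OF this, symmetric] show ?thesis
      using on by (simp add: w_def)
  qed
  show ?thesis
    using sym D[OF smi(1,3) x'(1), of "(0, 1)"] D[OF smi(2,4) x'(2), of "(1, 0)"]
    by (simp add: s' t' algebra_simps)
qed

text \<open>Let \<open>x' = x + l t\<close>. Since \<open>t\<^sub>u\<close> and \<open>s\<close> are orthogonal to \<open>t\<close>, the component of \<open>x'\<^sub>u\<close> along \<open>t\<close> is
  \<open>b\<^sub>1 + l\<^sub>u\<close>, and likewise for \<open>v\<close>. So \<open>t\<close> is normal to \<open>x'\<close> iff \<open>dl = - (b\<^sub>1 du + b\<^sub>2 dv)\<close>. This
  equation also makes \<open>l\<close> smooth, and \<open>(x', t, s)\<close> is then a mate if \<open>l\<close> is nonzero on a dense set: any smooth unit field orthogonal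
  to \<open>t\<close> can serve as its third component.\<close>
lemma mates_via_iff:
  assumes U: "open U"
    and fs: "framed_surface U x n s"
    and bi: "basic_invariants U x n s a1 b1 e1 f1 g1 a2 b2 e2 f2 g2"
  shows "(\<exists>x' n' s'. tn_mates_via U l x n s x' n' s') \<longleftrightarrow>
    not_ident_zero U l \<and> (\<forall>p\<in>U. (l has_derivative (\<lambda>h. - (b1 p * fst h + b2 p * snd h))) (at p))"
proof -
  define t where "t = frame_t n s"
  have sm: "smooth_on U x" "smooth_on U n" "smooth_on U s"
    using fs by (auto simp: framed_surface_def)
  have smt: "smooth_on U t" unfolding t_def by (rule smooth_on_frame_t[OF U(1) sm(2,3)])
  have smi: "smooth_on U b1" "smooth_on U b2"
    using bi by (auto simp: basic_invariants_def)
  note on = framed_surface_orthonormal[OF fs, folded t_def]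
  have normal: "partial_u x' p \<bullet> t p = b1 p + l' (1, 0)" "partial_v x' p \<bullet> t p = b2 p + l' (0, 1)"
    if p: "p \<in> U" and l: "(l has_derivative l') (at p)"
      and x': "\<And>q. q \<in> U \<Longrightarrow> x' q = x q + l q *\<^sub>R t q" for x' l' p
  proof -
    note dx = smooth_onD[OF sm(1) p] and dt = smooth_onD[OF smt p]
    have "((\<lambda>q. x q + l q *\<^sub>R t q) has_derivative (\<lambda>h. frechet_derivative x (at p) h +
        (l p *\<^sub>R frechet_derivative t (at p) h + l' h *\<^sub>R t p))) (at p)"
      by (intro has_derivative_add has_derivative_scaleR dx dt l)
    then have "(x' has_derivative (\<lambda>h. frechet_derivative x (at p) h +
        (l p *\<^sub>R frechet_derivative t (at p) h + l' h *\<^sub>R t p))) (at p)"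
      by (rule has_derivative_transform_within_open[OF _ U p]) (simp add: x')
    note dx' = partial_eq_derivative[OF this]
    show "partial_u x' p \<bullet> t p = b1 p + l' (1, 0)" "partial_v x' p \<bullet> t p = b2 p + l' (0, 1)"
      using bi p on[OF p] unfolding dx'
      by (simp_all add: basic_invariants_def Let_def t_def[symmetric] inner_add_left inner_diff_left
          partial_eq_derivative[OF dx, symmetric] partial_eq_derivative[OF dt, symmetric])
  qed
  show ?thesis
  proof (intro iffI conjI ballI; (elim conjE)?)
    assume "\<exists>x' n' s'. tn_mates_via U l x n s x' n' s'"
    then obtain x' n' s' where m: "tn_mates_via U l x n s x' n' s'" by blast
    then show "not_ident_zero U l" by (simp add: tn_mates_via_def)
    fix p assume p: "p \<in> U"
    have sl: "smooth_on U l" and fs': "framed_surface U x' n' s'"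
      and x': "\<And>q. q \<in> U \<Longrightarrow> x' q = x q + l q *\<^sub>R t q"
      and n': "n' p = t p"
      using m p by (auto simp: tn_mates_via_def t_def)
    define l' where "l' = frechet_derivative l (at p)"
    have l': "(l has_derivative l') (at p)" unfolding l'_def by (rule smooth_onD[OF sl p])
    have "partial_u x' p \<bullet> t p = 0" "partial_v x' p \<bullet> t p = 0"
      using fs' p by (simp_all add: framed_surface_def n'[symmetric])
    then have z: "l' (1, 0) = - b1 p" "l' (0, 1) = - b2 p"
      using normal[OF p l' x'] by linarith+
    have "l' h = - (b1 p * fst h + b2 p * snd h)" for h
    proof -
      have "h = fst h *\<^sub>R (1, 0) + snd h *\<^sub>R (0, 1)" by (cases h) simp
      then have "l' h = fst h *\<^sub>R l' (1, 0) + snd h *\<^sub>R l' (0, 1)"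
        using has_derivative_linear[OF l'] by (metis linear_add linear_cmul)
      then show ?thesis by (simp add: z mult.commute)
    qed
    then have "l' = (\<lambda>h. - (b1 p * fst h + b2 p * snd h))" by blast
    then show "(l has_derivative (\<lambda>h. - (b1 p * fst h + b2 p * snd h))) (at p)" using l' by simp
  next
    assume nz: "not_ident_zero U l"
      and dl: "\<forall>p\<in>U. (l has_derivative (\<lambda>h. - (b1 p * fst h + b2 p * snd h))) (at p)"
    have "Ck_on (Suc k) U l" for k
    proof (rule Ck_on_SucI[where f = l and f' = "\<lambda>p h. - (b1 p * fst h + b2 p * snd h)", OF U])
      fix h :: "real \<times> real"
      have "Ck_on k U (\<lambda>p. b1 p * (- fst h) + b2 p * (- snd h))"
        using smi unfolding smooth_on_def
        by (intro Ck_on_add U Ck_on_bilinear[OF _ bounded_bilinear_mult] Ck_on_const) auto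
      then show "Ck_on k U (\<lambda>p. - (b1 p * fst h + b2 p * snd h))" by simp
    qed (use dl in blast)
    then have sl: "smooth_on U l" unfolding smooth_on_def using Ck_on_lower by blast
    define x' where "x' q = x q + l q *\<^sub>R t q" for q
    have "smooth_on U x'"
      using sm(1) sl smt unfolding smooth_on_def x'_def
      by (auto intro!: Ck_on_add U Ck_on_bilinear[OF _ bounded_bilinear_scaleR])
    moreover have "(t p, s p) \<in> Delta" if "p \<in> U" for p
      using on[OF that] by (simp add: Delta_def norm_eq_1 inner_commute)
    moreover have "partial_u x' p \<bullet> t p = 0 \<and> partial_v x' p \<bullet> t p = 0" if "p \<in> U" for p
      using normal[OF that dl[rule_format, OF that], of x'] by (simp add: x'_def)
    ultimately have "framed_surface U x' t s"
      using smt sm(3) by (simp add: framed_surface_def)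
    then have "tn_mates_via U l x n s x' t s"
      using fs sl nz by (simp add: tn_mates_via_def x'_def t_def)
    then show "\<exists>x' n' s'. tn_mates_via U l x n s x' n' s'" by blast
  qed
qed

theorem theorem3p21:
  fixes U :: "(real \<times> real) set"
    and x n s :: "real \<times> real \<Rightarrow> real^3"
    and a1 b1 e1 f1 g1 a2 b2 e2 f2 g2 :: "real \<times> real \<Rightarrow> real"
  assumes "open U" and "connected U" and "U \<noteq> {}" and "simply_connected U"
    and "framed_surface U x n s"
    and "basic_invariants U x n s a1 b1 e1 f1 g1 a2 b2 e2 f2 g2"
  shows "(tn_bertrand U x n s \<longleftrightarrow>
            (\<forall>p\<in>U. det (vector [vector [g1 p, g2 p], vector [a1 p, a2 p]] :: real^2^2) = 0) \<and>
            (\<exists>l u0 v0 c. (u0, v0) \<in> U \<and> lambda_formula U b1 b2 u0 v0 c l \<and> not_ident_zero U l)) \<and>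
         (\<forall>l. (\<exists>x' n' s'. tn_mates_via U l x n s x' n' s') \<longleftrightarrow>
            (\<forall>p\<in>U. det (vector [vector [g1 p, g2 p], vector [a1 p, a2 p]] :: real^2^2) = 0) \<and>
            (\<exists>u0 v0 c. (u0, v0) \<in> U \<and> lambda_formula U b1 b2 u0 v0 c l \<and> not_ident_zero U l))"
proof -
  have "smooth_on U b1" "smooth_on U b2"
    using assms(6) by (auto simp: basic_invariants_def)
  then have C1: "Ck_on 1 U b1" "Ck_on 1 U b2"
    and cont: "continuous_on U b1" "continuous_on U b2"
    by (auto simp: smooth_on_def simp flip: Ck_on.simps(1) simp del: One_nat_def)
  have closed_iff: "det (vector [vector [g1 p, g2 p], vector [a1 p, a2 p]] :: real^2^2) = 0 \<longleftrightarrow>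
      frechet_derivative b1 (at p) (0, 1) = frechet_derivative b2 (at p) (1, 0)" if "p \<in> U" for p
    using integrability_condition[OF assms(1) that assms(5,6)] by (simp add: det_2) (auto simp: mult.commute)
  note mates_iff = mates_via_iff[OF assms(1,5,6)]
  have mates: "(\<exists>x' n' s'. tn_mates_via U l x n s x' n' s') \<longleftrightarrow>
            (\<forall>p\<in>U. det (vector [vector [g1 p, g2 p], vector [a1 p, a2 p]] :: real^2^2) = 0) \<and>
            (\<exists>u0 v0 c. (u0, v0) \<in> U \<and> lambda_formula U b1 b2 u0 v0 c l \<and> not_ident_zero U l)"
    (is "?mates = (?det \<and> ?formula)") for l
  proof
    assume ?mates
    then have nz: "not_ident_zero U l"
      and dl: "\<And>p. p \<in> U \<Longrightarrow> (l has_derivative (\<lambda>h. - (b1 p * fst h + b2 p * snd h))) (at p)"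
      unfolding mates_iff by auto
    have F: "((\<lambda>q. - l q) has_derivative (\<lambda>h. b1 p * fst h + b2 p * snd h)) (at p)" if "p \<in> U" for p
      using has_derivative_minus[OF dl[OF that]] by (simp only: minus_minus)
    have ?det
      using closed_iff potential_imp_closed[OF assms(1) _ F C1] by blast
    moreover obtain u0 v0 where p0: "(u0, v0) \<in> U" using assms(3) by auto
    have "lambda_formula U b1 b2 u0 v0 (l (u0, v0)) l"
      by (subst lambda_formula_iff_potential[OF assms(1,2) p0 F cont]) auto
    ultimately show "?det \<and> ?formula" using p0 nz by blast
  next
    assume r: "?det \<and> ?formula"
    then obtain u0 v0 c where p0: "(u0, v0) \<in> U" and lf: "lambda_formula U b1 b2 u0 v0 c l"
      and nz: "not_ident_zero U l" by blast
    have "frechet_derivative b1 (at p) (0, 1) = frechet_derivative b2 (at p) (1, 0)" if "p \<in> U" for p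
      using r closed_iff[OF that] that by blast
    then obtain F where F: "\<And>p. p \<in> U \<Longrightarrow> (F has_derivative (\<lambda>h. b1 p * fst h + b2 p * snd h)) (at p)"
      using poincare_simply_connected[OF assms(1,4) C1] by blast
    have l: "l p = - (F p - F (u0, v0)) + c" if "p \<in> U" for p
      using lf that lambda_formula_iff_potential[OF assms(1,2) p0 F cont] by blast
    have "(l has_derivative (\<lambda>h. - (b1 p * fst h + b2 p * snd h))) (at p)" if "p \<in> U" for p
    proof (rule has_derivative_transform_within_open[OF _ assms(1) that])
      show "((\<lambda>p. - (F p - F (u0, v0)) + c) has_derivative (\<lambda>h. - (b1 p * fst h + b2 p * snd h))) (at p)"
        by (auto intro!: derivative_eq_intros F[OF that])
    qed (simp add: l)
    then show ?mates unfolding mates_iff using nz by blast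
  qed
  have "tn_bertrand U x n s \<longleftrightarrow> (\<exists>l x' n' s'. tn_mates_via U l x n s x' n' s')"
    unfolding tn_bertrand_def tn_mates_def by (auto simp: tn_mates_via_def)
  then show ?thesis using mates by auto
qed

end
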